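(* Let $q$ be an odd prime power, let $b,c,d\in\mathbb{F}_{q^2}$, and let $f(x)=x^q+bx^2+cx+d\in\mathbb{F}_{q^2}[x]$. If either ($b=0$ and $c\in\mu_{q+1}$) or $b\neq 0$, then $f$ is not a permutation polynomial of $\mathbb{F}_{q^2}$.
   Context: $\mathbb{F}_{q^2}$ is the finite field with $q^2$ elements. A polynomial over $\mathbb{F}_{q^2}$ is a permutation polynomial of $\mathbb{F}_{q^2}$ if the map $x\mapsto f(x)$ is a bijection of $\mathbb{F}_{q^2}$ onto itself. $\mu_{q+1}=\{x\in\mathbb{F}_{q^2}^*: x^{q+1}=1\}$. *)

theory Defs
  imports "HOL-Library.Cardinality" "HOL-Number_Theory.Prime_Powers" "HOL-Computational_Algebra.Polynomial"
begin

definition permutation_poly :: "'a :: {finite, field} poly \<Rightarrow> bool" where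
  "permutation_poly f \<longleftrightarrow> bij (poly f)"

definition mu :: "nat \<Rightarrow> 'a :: field set" where
  "mu n = {x. x \<noteq> 0 \<and> x ^ n = 1}"

end

theory Submission
  imports "HOL-Number_Theory.Residues" Defs
begin

text \<open>
  Since \<open>q\<close> is a power of the characteristic, \<open>x \<mapsto> x\<^sup>q\<close> is additive, and therefore
  \<open>f (y + h) - f y = h\<^sup>q + (2 b y + b h + c) h\<close>. The map is not injective as soon as this
  expression vanishes for some \<open>y\<close> and some \<open>h \<noteq> 0\<close>.

  If \<open>b \<noteq> 0\<close>, the expression is affine in \<open>y\<close> with slope \<open>2 b h\<close>, which is nonzero because the
  characteristic is odd; so for any \<open>h \<noteq> 0\<close>, for instance \<open>h = 1\<close>, it has a zero \<open>y\<close>.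

  If \<open>b = 0\<close>, a solution of \<open>h\<^sup>q = - c h\<close> with \<open>h \<noteq> 0\<close> is required. Since \<open>q + 1\<close> is
  even, \<open>- c\<close> has norm \<open>(- c)\<^bsup>q + 1\<^esup> = c\<^bsup>q + 1\<^esup> = 1\<close> over the subfield of \<open>q\<close> elements,
  so such an \<open>h\<close> exists by Hilbert's Theorem 90 for the quadratic extension, lemma \<open>quadratic_hilbert90\<close>.
\<close>

text \<open>
  Multiplication by a nonzero \<open>x\<close> permutes the nonzero elements, so it leaves their product
  unchanged; cancelling that product gives \<open>x\<^bsup>n - 1\<^esup> = 1\<close> for the order \<open>n\<close> of the field.
\<close>

lemma power_card_field:
  fixes x :: "'a :: {finite, field}"
  shows "x ^ CARD('a) = x"
proof (cases "x = 0")
  case True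
  then show ?thesis by (simp add: power_0_left)
next
  case False
  let ?U = "UNIV - {0 :: 'a}"
  have "(\<Prod>y\<in>?U. y) = (\<Prod>y\<in>?U. x * y)"
    by (rule prod.reindex_bij_witness[of _ "\<lambda>y. x * y" "\<lambda>y. y / x"]) (use False in auto)
  also have "\<dots> = x ^ card ?U * (\<Prod>y\<in>?U. y)"
    by (simp add: prod.distrib)
  finally have "x ^ card ?U = 1" by simp
  moreover have "CARD('a) = Suc (card ?U)"
    using card_Suc_Diff1[of "UNIV :: 'a set" 0] by simp
  ultimately show ?thesis
    by (metis power_Suc mult.right_neutral)
qed

text \<open>
  The characteristic is a prime divisor of the order of the field, and \<open>q\<close> has only one prime
  divisor.
\<close>

lemma primepow_eq_CHAR_power:
  fixes q n :: nat
  assumes "primepow q" and "CARD('a :: {finite, field}) = q ^ n"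
  obtains k where "prime CHAR('a)" and "k > 0" and "q = CHAR('a) ^ k"
proof -
  obtain p k where p: "prime p" "k > 0" "q = p ^ k"
    using assms(1) by (auto simp: primepow_def)
  have prime: "prime CHAR('a)"
    by (simp add: finite_imp_CHAR_pos prime_CHAR_semidom)
  have "CHAR('a) dvd (p ^ k) ^ n"
    using CHAR_dvd_CARD[where ?'a = 'a] assms(2) p(3) by simp
  then have "CHAR('a) = p"
    using prime p(1) by (meson prime_dvd_power primes_dvd_imp_eq)
  with prime p that show thesis by blast
qed

text \<open>
  The trace-like element \<open>h = t + (e t)\<^sup>q\<close> is a solution for every \<open>t\<close>: the map \<open>x \<mapsto> x\<^sup>q\<close> is an
  involution and \<open>e\<^sup>q\<close> is the inverse of \<open>e\<close>, so it takes \<open>h\<close> to \<open>t\<^sup>q + e t = e h\<close>. Some \<open>t\<close> gives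
  a nonzero \<open>h\<close>, because a polynomial of degree \<open>q\<close> has fewer than \<open>q\<^sup>2\<close> roots.
\<close>

lemma quadratic_hilbert90:
  fixes e :: "'a :: {finite, field}"
  assumes "q > 1" and card: "CARD('a) = q ^ 2"
    and add: "\<And>x y :: 'a. (x + y) ^ q = x ^ q + y ^ q"
    and norm: "e ^ (q + 1) = 1"
  obtains h where "h \<noteq> 0" and "h ^ q = e * h"
proof -
  have involution: "(x ^ q) ^ q = x" for x :: 'a
    using power_card_field[of x] card by (simp add: power2_eq_square power_mult)
  have e_inv: "e * e ^ q = 1" and "e \<noteq> 0"
    using norm by (auto simp: power_0_left)
  define P where "P = monom (e ^ q) q + monom 1 1"
  have "coeff P q \<noteq> 0"
    using \<open>e \<noteq> 0\<close> \<open>q > 1\<close> by (simp add: P_def)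
  then have "P \<noteq> 0" by auto
  have "degree P \<le> q"
    unfolding P_def by (rule degree_le) (use \<open>q > 1\<close> in auto)
  then have "card {t. poly P t = 0} \<le> q"
    using card_poly_roots_bound[OF \<open>P \<noteq> 0\<close>] by linarith
  also have "q < CARD('a)"
    using card \<open>q > 1\<close> by (simp add: power2_eq_square)
  finally obtain t where "poly P t \<noteq> 0"
    by (cases "\<exists>t. poly P t \<noteq> 0") auto
  then have nz: "t + (e * t) ^ q \<noteq> 0"
    by (simp add: P_def poly_monom power_mult_distrib add.commute)
  have "(t + (e * t) ^ q) ^ q = t ^ q + e * t"
    by (simp add: add involution)
  also have "\<dots> = e * e ^ q * t ^ q + e * t"
    by (simp add: e_inv)
  also have "\<dots> = e * (t + (e * t) ^ q)"
    by (simp add: power_mult_distrib algebra_simps)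
  finally show thesis using nz that by blast
qed

theorem theorem3p6:
  fixes q :: nat
    and b c d :: "'a :: {finite, field}"
    and f :: "'a poly"
  assumes "primepow q" and "odd q"
    and "CARD('a) = q ^ 2"
    and "f = monom 1 q + monom b 2 + monom c 1 + [:d:]"
    and "(b = 0 \<and> c \<in> mu (q + 1)) \<or> b \<noteq> 0"
  shows "\<not> permutation_poly f"
proof -
  obtain k where k: "prime CHAR('a)" "k > 0" "q = CHAR('a) ^ k"
    using primepow_eq_CHAR_power[OF assms(1,3)] .
  have add: "(x + y) ^ q = x ^ q + y ^ q" for x y :: 'a
    using freshmans_dream'[OF k(1,3)] .
  have difference: "poly f (y + h) - poly f y = h ^ q + (2 * b * y + b * h + c) * h" for y h
    by (simp add: assms(4) poly_monom add power2_eq_square algebra_simps)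
  have "\<exists>y h. h \<noteq> 0 \<and> h ^ q + (2 * b * y + b * h + c) * h = 0"
  proof (cases "b = 0")
    case True
    have "(- c) ^ (q + 1) = 1"
      using True assms(2,5) by (auto simp: mu_def)
    moreover have "q > 1"
      using primepow_gt_Suc_0[OF assms(1)] by simp
    ultimately obtain h where "h \<noteq> 0" "h ^ q = - c * h"
      using quadratic_hilbert90[OF _ assms(3) add] by blast
    then have "h ^ q + (2 * b * 0 + b * h + c) * h = 0"
      using True by simp
    with \<open>h \<noteq> 0\<close> show ?thesis by blast
  next
    case False
    have "\<not> CHAR('a) dvd 2"
    proof
      assume "CHAR('a) dvd 2"
      then have "CHAR('a) = 2"
        using k(1) two_is_prime_nat by (simp add: primes_dvd_imp_eq)
      then show False using assms(2) k(2,3) by simp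
    qed
    then have "(2 :: 'a) \<noteq> 0"
      using of_nat_eq_0_iff_char_dvd[of 2, where ?'a = 'a] by simp
    with False have "2 * b * (- (1 + b + c) / (2 * b)) = - (1 + b + c)"
      by simp
    then have "1 ^ q + (2 * b * (- (1 + b + c) / (2 * b)) + b * 1 + c) * 1 = 0"
      by simp
    with one_neq_zero show ?thesis by blast
  qed
  then obtain y h where "h \<noteq> 0" "poly f (y + h) = poly f y"
    using difference by (metis eq_iff_diff_eq_0)
  then have "\<not> inj (poly f)"
    by (metis add_cancel_left_right injD)
  then show ?thesis
    by (simp add: permutation_poly_def bij_def)
qed

end
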